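(* Let $d,m\in\mathbb{N}$, let $\vec{a}\in\mathbb{R}^d$, and for each prime $p$ and each $1\le l\le m$ let $\alpha_l(p)\in\{-1,0,1\}$. For $\vec{s}\in\mathbb{C}^d$ with $\Re\langle\vec{a},\vec{s}\rangle>1$ put $$Z_E(\vec{s})=\prod_{p}\prod_{l=1}^m\left(1-\alpha_l(p)p^{-\langle\vec{a},\vec{s}\rangle}\right)^{-1},$$ where $p$ runs over all primes. Let $\vec{\sigma}\in\mathbb{R}^d$ satisfy $\langle\vec{a},\vec{\sigma}\rangle>1$ and put $f_{\vec{\sigma}}(\vec{t})=Z_E(\vec{\sigma}+\mathrm{i}\vec{t})/Z_E(\vec{\sigma})$ for $\vec{t}\in\mathbb{R}^d$. Then $f_{\vec{\sigma}}$ is a characteristic function if and only if $\sum_{l=1}^m\alpha_l(p)\ge 0$ for all primes $p$. Moreover, when $\sum_{l=1}^m\alpha_l(p)\ge 0$ for all primes $p$, $f_{\vec{\sigma}}$ is a compound Poisson characteristic function with its finite Lévy measure $N^{(\vec{a})}_{\vec{\sigma}}$ on $\mathbb{R}^d$ given by $$N^{(\vec{a})}_{\vec{\sigma}}(dx)=\sum_p\sum_{r=1}^\infty\sum_{l=1}^m\frac{1}{r}\alpha_l(p)^r p^{-r\langle\vec{a},\vec{\sigma}\rangle}\,\delta_{\log p^r\,\vec{a}}(dx).$$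
   Context: For $\vec{a}\in\mathbb{R}^d$ and $\vec{s}\in\mathbb{C}^d$, $\langle\vec{a},\vec{s}\rangle=\sum_{j=1}^d a_js_j$, and $p^{-w}=e^{-w\log p}$ for $w\in\mathbb{C}$. $\delta_x$ is the delta measure at $x$, and $\log p^r\,\vec{a}$ denotes the vector $(r\log p)\vec{a}$. A characteristic function is a function of the form $\widehat{\mu}(\vec{t})=\int_{\mathbb{R}^d}e^{\mathrm{i}\langle\vec{t},x\rangle}\mu(dx)$, $\vec{t}\in\mathbb{R}^d$, with $\mu$ a probability measure on $\mathbb{R}^d$. A compound Poisson characteristic function is one of the form $\vec{t}\mapsto\exp(c(\widehat{\rho}(\vec{t})-1))$ for some $c>0$ and some probability measure $\rho$ on $\mathbb{R}^d$ with $\rho(\{0\})=0$. The Lévy measure of an infinitely divisible distribution $\mu$ on $\mathbb{R}^d$ is the measure $\nu$, with $\nu(\{0\})=0$ and $\int(|x|^2\wedge 1)\nu(dx)<\infty$, in its unique Lévy–Khintchine representation $\widehat{\mu}(\vec{t})=\exp\left[-\tfrac12\langle\vec{t},A\vec{t}\rangle+\mathrm{i}\langle\gamma,\vec{t}\rangle+\int_{\mathbb{R}^d}\left(e^{\mathrm{i}\langle\vec{t},x\rangle}-1-\frac{\mathrm{i}\langle\vec{t},x\rangle}{1+|x|^2}\right)\nu(dx)\right]$, where $A$ is a symmetric nonnegative-definite $d\times d$ matrix and $\gamma\in\mathbb{R}^d$.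
   Formalization: With the stated sign convention the Lévy measure is the image of N under x ↦ -x (masses at -log p^r a), and this is what is proved; "compound Poisson" is claimed only if some α_l(p) is nonzero, since otherwise f = 1, which is not compound Poisson with c > 0 and ρ({0}) = 0. *)

theory Defs
  imports
    "HOL-Probability.Probability"
    "HOL-Computational_Algebra.Primes"
begin

text \<open>The bilinear (not Hermitian) pairing of a real and a complex vector.\<close>

definition pairing :: "real ^ 'd \<Rightarrow> complex ^ 'd \<Rightarrow> complex" where
  "pairing a s = (\<Sum>j\<in>UNIV. complex_of_real (a $ j) * s $ j)"

text \<open>
  The product over all primes is taken in increasing order; it converges absolutely when the real
  part of the pairing exceeds 1.
\<close>

definition euler_Z :: "nat \<Rightarrow> (nat \<Rightarrow> nat \<Rightarrow> int) \<Rightarrow> real ^ 'd \<Rightarrow> complex ^ 'd \<Rightarrow> complex" where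
  "euler_Z m \<alpha> a s =
     (\<Prod>p. if prime p
            then (\<Prod>l = 1..m. inverse (1 - of_int (\<alpha> l p) * of_nat p powr (- pairing a s)))
            else 1)"

definition normalized_Z ::
  "nat \<Rightarrow> (nat \<Rightarrow> nat \<Rightarrow> int) \<Rightarrow> real ^ 'd \<Rightarrow> real ^ 'd \<Rightarrow> real ^ 'd \<Rightarrow> complex" where
  "normalized_Z m \<alpha> a \<sigma> t =
     euler_Z m \<alpha> a (\<chi> j. complex_of_real (\<sigma> $ j) + \<i> * complex_of_real (t $ j))
       / euler_Z m \<alpha> a (\<chi> j. complex_of_real (\<sigma> $ j))"

text \<open>
  The library's \<^const>\<open>char\<close> is restricted to measures on the real line.
\<close>

definition char_vec :: "(real ^ 'd) measure \<Rightarrow> real ^ 'd \<Rightarrow> complex" where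
  "char_vec M t = (CLINT x|M. iexp (t \<bullet> x))"

definition prob_on_space :: "(real ^ 'd) measure \<Rightarrow> bool" where
  "prob_on_space M \<longleftrightarrow> prob_space M \<and> sets M = sets borel"

definition is_char_fun :: "(real ^ 'd \<Rightarrow> complex) \<Rightarrow> bool" where
  "is_char_fun \<phi> \<longleftrightarrow> (\<exists>\<mu>. prob_on_space \<mu> \<and> (\<forall>t. \<phi> t = char_vec \<mu> t))"

definition is_compound_poisson_char_fun :: "(real ^ 'd \<Rightarrow> complex) \<Rightarrow> bool" where
  "is_compound_poisson_char_fun \<phi> \<longleftrightarrow>
     (\<exists>c \<rho>. c > 0 \<and> prob_on_space \<rho> \<and> emeasure \<rho> {0} = 0 \<and>
            (\<forall>t. \<phi> t = exp (complex_of_real c * (char_vec \<rho> t - 1))))"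

definition infinitely_divisible :: "(real ^ 'd) measure \<Rightarrow> bool" where
  "infinitely_divisible \<mu> \<longleftrightarrow> prob_on_space \<mu> \<and>
     (\<forall>n\<ge>1. \<exists>\<mu>'. prob_on_space \<mu>' \<and> (\<forall>t. char_vec \<mu> t = char_vec \<mu>' t ^ n))"

text \<open>The L\'evy--Khintchine representation with truncation function $x / (1 + |x|^2)$.\<close>

definition is_levy_measure :: "(real ^ 'd) measure \<Rightarrow> (real ^ 'd) measure \<Rightarrow> bool" where
  "is_levy_measure \<mu> \<nu> \<longleftrightarrow>
     infinitely_divisible \<mu> \<and>
     sets \<nu> = sets borel \<and> emeasure \<nu> {0} = 0 \<and>
     (\<integral>\<^sup>+ x. ennreal (min ((norm x)\<^sup>2) 1) \<partial>\<nu>) < \<infinity> \<and>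
     (\<exists>A \<gamma>. transpose A = A \<and> (\<forall>t. 0 \<le> t \<bullet> (A *v t)) \<and>
        (\<forall>t. char_vec \<mu> t =
           exp (- complex_of_real (t \<bullet> (A *v t)) / 2 + \<i> * complex_of_real (\<gamma> \<bullet> t)
             + (CLINT x|\<nu>. iexp (t \<bullet> x) - 1
                  - \<i> * complex_of_real (t \<bullet> x) / complex_of_real (1 + (norm x)\<^sup>2)))))"

text \<open>
  The sum of point masses over pairs \<open>(p, r)\<close> of a prime and a positive integer is encoded as the
  push-forward, under the location map, of the weights on the countable index set. The sum over
  \<open>l\<close> is taken inside the weight because its individual terms may be negative. Under the hypothesis
  that the sum over \<open>l\<close> of the \<open>\<alpha> l p\<close> is nonnegative for all primes \<open>p\<close>, all weights are
  nonnegative and the truncation by \<^const>\<open>ennreal\<close> is harmless.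
\<close>

definition euler_N ::
  "nat \<Rightarrow> (nat \<Rightarrow> nat \<Rightarrow> int) \<Rightarrow> real ^ 'd \<Rightarrow> real ^ 'd \<Rightarrow> (real ^ 'd) measure" where
  "euler_N m \<alpha> a \<sigma> =
     distr
       (point_measure ({p. prime p} \<times> {1..})
          (\<lambda>(p, r). ennreal (\<Sum>l = 1..m.
             1 / real r * real_of_int (\<alpha> l p) ^ r * real p powr (- real r * (a \<bullet> \<sigma>)))))
       borel
       (\<lambda>(p, r). (real r * ln (real p)) *\<^sub>R a)"

text \<open>
  Sign convention: since $p^{-r\langle a, \sigma + i t\rangle}$ oscillates like
  $e^{-i\langle t, x\rangle}$ at the point $x = (r \log p) a$, one has
  $f_\sigma(t) = \exp \int (e^{-i\langle t, x\rangle} - 1) N(dx)$ with $N$ as in \<open>euler_N\<close>. With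
  characteristic functions normalised by $e^{+i\langle t, x\rangle}$, as in \<open>char_vec\<close>, the
  L\'evy measure is therefore the image of $N$ under $x \mapsto -x$.
\<close>

definition reflect :: "(real ^ 'd) measure \<Rightarrow> (real ^ 'd) measure" where
  "reflect N = distr N borel uminus"

end

theory Submission
  imports Defs
begin

text \<open>
  Taking logarithms of the local factors, absolute convergence for \<open>\<langle>a, \<sigma>\<rangle> > 1\<close> gives
    \<open>f(t) = exp (\<Sum>p r. w(p, r) ((p\<^sup>r)\<^bsup>-i\<langle>a, t\<rangle>\<^esup> - 1))\<close>,  \<open>w(p, r) = 1/r (\<Sum>l. \<alpha> l p ^ r) p\<^bsup>-r\<langle>a, \<sigma>\<rangle>\<^esup>\<close>,
  with absolutely summable real weights (\<open>normalized_Z_eq_exp\<close>).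

  If \<open>\<Sum>l. \<alpha> l p \<ge> 0\<close> for all primes, all weights are nonnegative, because odd powers of
  \<open>-1, 0, 1\<close> do nothing and even powers are nonnegative. The formula is then the exponent of a
  compound Poisson law: it is the law of \<open>- log n \<cdot> a\<close>, where \<open>n\<close> is the product of a Poisson
  number of independent random prime powers (\<open>compound_poisson_exists\<close>, \<open>prime_power_law_exists\<close>). Dividing
  the weights by an integer gives convolution roots, and the finite measure of jumps is the L\'evy
  measure, with drift equal to the integral of the truncation function (\<open>is_levy_measure_finite\<close>).

  For the converse, note that \<open>w(q, 1)\<close> has the sign of \<open>\<Sum>l. \<alpha> l q\<close>. Signed weights may well
  produce characteristic functions in general, so the argument has to use that \<open>q\<close> is prime. Splitting
  the weights into positive and negative parts turns the hypothesis into an identity between a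
  convolution of \<open>\<mu>\<close> with one compound Poisson law and another compound Poisson law, by uniqueness of
  characteristic functions on the real line. Both compound Poisson laws come from random integers, and
  if \<open>w(q, 1) < 0\<close>, the one that carries the positive weights never takes the value \<open>q\<close>: a product
  equal to a prime has a factor equal to it, and the jump \<open>q\<close> belongs to the negative part. Comparing
  supports gives a contradiction (\<open>weight_at_prime_nonneg\<close>).
\<close>

text \<open>
  Infinite sums are integrals against counting measure (\<^const>\<open>infsetsum\<close>), so that integrals over
  discrete measures turn into sums by the density formula alone.
\<close>

no_notation Infinite_Sum.abs_summable_on (infixr \<open>abs'_summable'_on\<close> 46)

section \<open>Poisson products in a countable monoid\<close>

lemma expectation_conv_infsetsum:
  fixes f :: "'a \<Rightarrow> 'b::{banach, second_countable_topology}"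
  shows "measure_pmf.expectation p f = (\<Sum>\<^sub>ax\<in>UNIV. pmf p x *\<^sub>R f x)"
  unfolding infsetsum_def measure_pmf_eq_density by (subst integral_density) simp_all

text \<open>
  Both types being countable, each expectation is an absolutely convergent series, and the law of
  total expectation is an exchange of two summations.
\<close>

lemma expectation_bind_pmf_bounded:
  fixes N :: "'a::countable \<Rightarrow> 'b::countable pmf" and f :: "'b \<Rightarrow> 'c::{banach, second_countable_topology}"
  assumes B: "\<And>y. norm (f y) \<le> B"
  shows "measure_pmf.expectation (bind_pmf M N) f =
           measure_pmf.expectation M (\<lambda>x. measure_pmf.expectation (N x) f)"
proof -
  have 1: "(\<lambda>(x,y). pmf M x * pmf (N x) y) abs_summable_on UNIV \<times> UNIV"
    by (subst abs_summable_on_Sigma_iff)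
       (auto simp: abs_mult infsetsum_cmult_right[OF pmf_abs_summable] infsetsum_pmf_eq_1
             intro!: abs_summable_on_cmult_right pmf_abs_summable)
  have 2: "(\<lambda>(x,y). (pmf M x * pmf (N x) y) *\<^sub>R f y) abs_summable_on UNIV \<times> UNIV"
  proof (rule abs_summable_on_comparison_test)
    show "(\<lambda>z. B * (case z of (x,y) \<Rightarrow> pmf M x * pmf (N x) y)) abs_summable_on UNIV \<times> UNIV"
      by (intro abs_summable_on_cmult_right 1)
    fix z :: "'a \<times> 'b"
    have "B \<ge> 0" using B[of undefined] norm_ge_zero order_trans by blast
    show "norm (case z of (x,y) \<Rightarrow> (pmf M x * pmf (N x) y) *\<^sub>R f y) \<le> norm (B * (case z of (x,y) \<Rightarrow> pmf M x * pmf (N x) y))"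
      using B[of "snd z"] \<open>B \<ge> 0\<close>
      by (auto simp: abs_mult case_prod_unfold mult.commute[of B] intro!: mult_left_mono)
  qed
  have "measure_pmf.expectation (bind_pmf M N) f = (\<Sum>\<^sub>ay\<in>UNIV. \<Sum>\<^sub>ax\<in>UNIV. (pmf M x * pmf (N x) y) *\<^sub>R f y)"
    unfolding expectation_conv_infsetsum
  proof (intro infsetsum_cong refl)
    fix y
    have "pmf (bind_pmf M N) y = (\<Sum>\<^sub>ax\<in>UNIV. pmf M x * pmf (N x) y)"
      by (simp add: pmf_bind expectation_conv_infsetsum)
    moreover have "(\<lambda>x. pmf M x * pmf (N x) y) abs_summable_on UNIV"
      by (rule abs_summable_on_comparison_test'[where g="pmf M"])
         (auto simp: abs_mult pmf_le_1 intro: mult_left_le)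
    ultimately show "pmf (bind_pmf M N) y *\<^sub>R f y = (\<Sum>\<^sub>ax\<in>UNIV. (pmf M x * pmf (N x) y) *\<^sub>R f y)"
      by (simp add: infsetsum_scaleR_left)
  qed
  also have "\<dots> = (\<Sum>\<^sub>ax\<in>UNIV. \<Sum>\<^sub>ay\<in>UNIV. (pmf M x * pmf (N x) y) *\<^sub>R f y)"
    using 2 by (intro infsetsum_swap[symmetric]) auto
  also have "\<dots> = measure_pmf.expectation M (\<lambda>x. measure_pmf.expectation (N x) f)"
  proof -
    have "(\<Sum>\<^sub>ay\<in>UNIV. (pmf M x * pmf (N x) y) *\<^sub>R f y) = pmf M x *\<^sub>R (\<Sum>\<^sub>ay\<in>UNIV. pmf (N x) y *\<^sub>R f y)" for x
    proof -
      have "(\<lambda>y. pmf (N x) y *\<^sub>R f y) abs_summable_on UNIV"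
        by (rule abs_summable_on_comparison_test'[where g="\<lambda>y. B * pmf (N x) y"])
           (auto simp: mult.commute[of B] intro!: mult_left_mono B abs_summable_on_cmult_right)
      then show ?thesis by (simp flip: scaleR_scaleR add: infsetsum_scaleR_right)
    qed
    then show ?thesis unfolding expectation_conv_infsetsum by simp
  qed
  finally show ?thesis .
qed

primrec power_pmf :: "'a::monoid_mult pmf \<Rightarrow> nat \<Rightarrow> 'a pmf" where
  "power_pmf S 0 = return_pmf 1"
| "power_pmf S (Suc k) = bind_pmf S (\<lambda>x. map_pmf ((*) x) (power_pmf S k))"

text \<open>
  This is the compound Poisson law of a multiplicative monoid: the product of a Poisson number of
  independent factors distributed as \<open>S\<close>. It is taken on an abstract monoid so that it can be used on
  the multiplicative monoid of the naturals, where primality is visible; the logarithm then carries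
  it to an ordinary compound Poisson law.
\<close>

definition poisson_product :: "real \<Rightarrow> 'a::monoid_mult pmf \<Rightarrow> 'a pmf" where
  "poisson_product c S = bind_pmf (poisson_pmf c) (power_pmf S)"

text \<open>
  The bound is 1 rather than an equality so that functions that vanish at a non-invertible element,
  such as \<open>n \<mapsto> n powr (- \<i> u)\<close> at 0, are included.
\<close>

definition bounded_character :: "('a::monoid_mult \<Rightarrow> complex) \<Rightarrow> bool" where
  "bounded_character h \<longleftrightarrow> h 1 = 1 \<and> (\<forall>x y. h (x * y) = h x * h y) \<and> (\<forall>x. norm (h x) \<le> 1)"

lemma abs_summable_character_weights:
  fixes v :: "'i \<Rightarrow> real"
  assumes h: "bounded_character h" and v: "v abs_summable_on A"
  shows "(\<lambda>z. v z *\<^sub>R h (g z)) abs_summable_on A"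
    and "(\<lambda>z. v z *\<^sub>R (h (g z) - 1)) abs_summable_on A"
proof -
  show 1: "(\<lambda>z. v z *\<^sub>R h (g z)) abs_summable_on A"
    by (rule abs_summable_on_comparison_test[OF v])
       (use h in \<open>auto simp: bounded_character_def intro: mult_left_le\<close>)
  have "(\<lambda>z. v z *\<^sub>R (1::complex)) abs_summable_on A"
    by (rule abs_summable_on_comparison_test[OF v]) simp
  from abs_summable_on_diff[OF 1 this]
  show "(\<lambda>z. v z *\<^sub>R (h (g z) - 1)) abs_summable_on A"
    by (simp only: scaleR_diff_right)
qed

text \<open>
  A character turns products of independent factors into products of expectations.
\<close>

lemma expectation_power_pmf:
  fixes S :: "'a::{monoid_mult, countable} pmf"
  assumes h: "bounded_character h"
  shows "measure_pmf.expectation (power_pmf S k) h = measure_pmf.expectation S h ^ k"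
proof (induction k)
  case 0 then show ?case using h by (simp add: bounded_character_def)
next
  case (Suc k)
  have "measure_pmf.expectation (power_pmf S (Suc k)) h =
      measure_pmf.expectation S (\<lambda>x. measure_pmf.expectation (power_pmf S k) (\<lambda>y. h x * h y))"
    using h by (simp add: expectation_bind_pmf_bounded[where B=1] bounded_character_def)
  then show ?case by (simp add: Suc)
qed

text \<open>
  Conditioning on the number of factors gives the exponential series in the expectation of \<open>h\<close>
  under \<open>S\<close>, weighted by the Poisson probabilities.
\<close>

lemma expectation_poisson_product:
  fixes S :: "'a::{monoid_mult, countable} pmf"
  assumes h: "bounded_character h" and c: "c > 0"
  shows "measure_pmf.expectation (poisson_product c S) h =
           exp (of_real c * (measure_pmf.expectation S h - 1))"
proof -
  define z where "z = measure_pmf.expectation S h"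
  have "norm z \<le> measure_pmf.expectation S (\<lambda>x. norm (h x))"
    unfolding z_def by (rule integral_norm_bound)
  also have "\<dots> \<le> 1"
    using h by (intro measure_pmf.integral_le_const measure_pmf.integrable_const_bound[of _ 1])
               (auto simp: bounded_character_def)
  finally have nz: "norm z \<le> 1" .
  have "measure_pmf.expectation (poisson_product c S) h = (\<Sum>\<^sub>ak\<in>UNIV. pmf (poisson_pmf c) k *\<^sub>R z ^ k)"
    using h unfolding poisson_product_def
    by (subst expectation_bind_pmf_bounded[where B=1])
       (auto simp: bounded_character_def expectation_power_pmf[OF h] z_def[symmetric]
          expectation_conv_infsetsum[of "poisson_pmf c"] simp del: pmf_poisson)
  also have "\<dots> = (\<Sum>k. pmf (poisson_pmf c) k *\<^sub>R z ^ k)"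
  proof (rule infsetsum_nat', rule abs_summable_on_comparison_test'[where g="pmf (poisson_pmf c)"])
    show "norm (pmf (poisson_pmf c) k *\<^sub>R z ^ k) \<le> pmf (poisson_pmf c) k" for k
      using nz by (simp add: norm_power power_le_one mult_left_le del: pmf_poisson)
  qed auto
  also have "\<dots> = (\<Sum>k. of_real (exp (-c)) * ((of_real c * z) ^ k /\<^sub>R fact k))"
    using c by (intro suminf_cong) (simp add: scaleR_conv_of_real power_mult_distrib divide_inverse)
  also have "\<dots> = of_real (exp (-c)) * exp (of_real c * z)"
    unfolding exp_def by (rule suminf_mult) (rule summable_exp_generic)
  also have "\<dots> = exp (of_real c * (z - 1))"
    by (simp add: algebra_simps flip: exp_add exp_of_real)
  finally show ?thesis by (simp add: z_def)
qed

lemma set_pmf_power_pmf_subset: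
  assumes "1 \<in> M" "\<And>x y. x \<in> M \<Longrightarrow> y \<in> M \<Longrightarrow> x * y \<in> M" "set_pmf S \<subseteq> M"
  shows "set_pmf (power_pmf S k) \<subseteq> M"
proof (induction k)
  case 0 then show ?case using assms by simp
next
  case (Suc k) then show ?case using assms by (fastforce simp: set_bind_pmf)
qed

lemma set_pmf_poisson_product:
  assumes "c > 0"
  shows "set_pmf (poisson_product c S) = (\<Union>k. set_pmf (power_pmf S k))"
  using assms by (simp add: poisson_product_def)

text \<open>
  A finite measure of jumps is normalised to a law \<open>S\<close> and its mass becomes the Poisson rate; mass 0
  gives the point mass at the unit. The three support properties are what the necessity argument
  consumes: the unit is attained by the empty product, each jump of positive weight by a product with
  one factor, and all products stay in any submonoid that contains the jumps.
\<close>

lemma compound_poisson_exists: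
  fixes g :: "'i \<Rightarrow> 'a::{monoid_mult, countable}" and v :: "'i \<Rightarrow> real"
  assumes nonneg: "\<And>x. x \<in> A \<Longrightarrow> v x \<ge> 0" and summable: "v abs_summable_on A"
  obtains P :: "'a pmf" where
    "\<And>h. bounded_character h \<Longrightarrow>
       measure_pmf.expectation P h = exp (\<Sum>\<^sub>ax\<in>A. v x *\<^sub>R (h (g x) - 1))"
    "1 \<in> set_pmf P"
    "\<And>x. x \<in> A \<Longrightarrow> v x > 0 \<Longrightarrow> g x \<in> set_pmf P"
    "\<And>M. 1 \<in> M \<Longrightarrow> (\<And>x y. x \<in> M \<Longrightarrow> y \<in> M \<Longrightarrow> x * y \<in> M) \<Longrightarrow>
       (\<And>x. x \<in> A \<Longrightarrow> v x > 0 \<Longrightarrow> g x \<in> M) \<Longrightarrow> set_pmf P \<subseteq> M"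
proof (cases "\<exists>x\<in>A. v x \<noteq> 0")
  case False
  then have "(\<Sum>\<^sub>ax\<in>A. v x *\<^sub>R (h (g x) - 1)) = 0" for h :: "'a \<Rightarrow> complex"
    by (intro infsetsum_all_0) auto
  with False show ?thesis
    by (intro that[of "return_pmf 1"]) (auto simp: bounded_character_def)
next
  case True
  define V where "V = infsetsum v A"
  have Vnn: "nn_integral (count_space A) v = ennreal V"
    unfolding V_def using summable nonneg by (rule nn_integral_conv_infsetsum)
  from True obtain x0 where x0: "x0 \<in> A" "v x0 > 0" using nonneg by force
  have "v x0 = infsetsum v {x0}" by simp
  also have "\<dots> \<le> V" unfolding V_def
    by (rule infsetsum_mono_neutral_left) (use x0 summable nonneg in auto)
  finally have V: "V > 0" using x0 by simp
  define w where "w x = (if x \<in> A then v x / V else 0)" for x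
  have w_nonneg: "w x \<ge> 0" for x using nonneg V by (simp add: w_def)
  have "(\<integral>\<^sup>+x. ennreal (w x) \<partial>count_space UNIV) = (\<integral>\<^sup>+x. ennreal (v x) / ennreal V \<partial>count_space A)"
    using V nonneg
    by (subst (2) nn_integral_count_space_indicator)
       (auto intro!: nn_integral_cong simp: w_def divide_ennreal split: split_indicator)
  also have "\<dots> = 1" using V Vnn by (simp add: nn_integral_divide divide_ennreal)
  finally have w1: "(\<integral>\<^sup>+x. ennreal (w x) \<partial>count_space UNIV) = 1" .
  define R where "R = embed_pmf w"
  have pmfR: "pmf R x = w x" for x unfolding R_def by (rule pmf_embed_pmf[OF w_nonneg w1])
  have setR: "set_pmf R = {x \<in> A. v x > 0}"
    using nonneg V unfolding set_pmf_eq pmfR w_def by (auto simp: less_le)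
  define S where "S = map_pmf g R"
  show ?thesis
  proof (rule that[of "poisson_product V S"])
    fix h :: "'a \<Rightarrow> complex" assume h: "bounded_character h"
    have sh: "(\<lambda>x. v x *\<^sub>R h (g x)) abs_summable_on A"
      by (rule abs_summable_character_weights(1)[OF h summable])
    have "of_real V * measure_pmf.expectation S h = V *\<^sub>R (\<Sum>\<^sub>ax\<in>UNIV. w x *\<^sub>R h (g x))"
      by (simp only: S_def integral_map_pmf)
         (simp add: expectation_conv_infsetsum pmfR scaleR_conv_of_real)
    also have "(\<Sum>\<^sub>ax\<in>UNIV. w x *\<^sub>R h (g x)) = (\<Sum>\<^sub>ax\<in>A. (1/V) *\<^sub>R (v x *\<^sub>R h (g x)))"
      by (intro infsetsum_cong_neutral) (auto simp: w_def)
    also have "\<dots> = (1/V) *\<^sub>R (\<Sum>\<^sub>ax\<in>A. v x *\<^sub>R h (g x))"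
      by (intro infsetsum_scaleR_right sh)
    finally have "of_real V * (measure_pmf.expectation S h - 1) = (\<Sum>\<^sub>ax\<in>A. v x *\<^sub>R h (g x)) - of_real V"
      using V by (simp add: algebra_simps)
    also have "\<dots> = (\<Sum>\<^sub>ax\<in>A. v x *\<^sub>R h (g x)) - (\<Sum>\<^sub>ax\<in>A. v x *\<^sub>R (1::complex))"
      unfolding V_def by (simp add: scaleR_conv_of_real infsetsum_of_real)
    also have "\<dots> = (\<Sum>\<^sub>ax\<in>A. v x *\<^sub>R (h (g x) - 1))"
      unfolding scaleR_diff_right
      by (rule infsetsum_diff[symmetric, OF sh]) (use summable in \<open>simp add: scaleR_conv_of_real\<close>)
    finally show "measure_pmf.expectation (poisson_product V S) h = exp (\<Sum>\<^sub>ax\<in>A. v x *\<^sub>R (h (g x) - 1))"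
      by (simp add: expectation_poisson_product[OF h V])
  next
    have "1 \<in> set_pmf (power_pmf S 0)" by simp
    then show "1 \<in> set_pmf (poisson_product V S)"
      using V set_pmf_poisson_product by blast
  next
    fix x assume "x \<in> A" "v x > 0"
    then have "g x \<in> set_pmf (power_pmf S 1)" by (auto simp: S_def setR)
    then show "g x \<in> set_pmf (poisson_product V S)"
      using V set_pmf_poisson_product by blast
  next
    fix M assume M: "1 \<in> M" "\<And>x y. x \<in> M \<Longrightarrow> y \<in> M \<Longrightarrow> x * y \<in> M" "\<And>x. x \<in> A \<Longrightarrow> v x > 0 \<Longrightarrow> g x \<in> M"
    then have "set_pmf S \<subseteq> M" by (auto simp: S_def setR)
    then show "set_pmf (poisson_product V S) \<subseteq> M"
      using set_pmf_power_pmf_subset[of M S] M V by (auto simp: set_pmf_poisson_product)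
  qed
qed

section \<open>The Euler product as the exponential of a sum over prime powers\<close>

definition prime_power_index :: "(nat \<times> nat) set" where
  "prime_power_index = {p. prime p} \<times> {1..}"

definition nat_character :: "real \<Rightarrow> nat \<Rightarrow> complex" where
  "nat_character u n = of_nat n powr (- \<i> * of_real u)"

lemma bounded_character_nat_character: "bounded_character (nat_character u)"
  unfolding bounded_character_def nat_character_def
  by (auto simp: powr_times_real norm_powr_real_powr)

lemma nat_character_eq_iexp: "n > 0 \<Longrightarrow> nat_character u n = iexp (- (u * ln (real n)))"
  by (simp add: nat_character_def powr_def mult.assoc flip: Ln_of_nat)

text \<open>
  The coefficient of \<open>(p\<^sup>r)\<^bsup>-iu\<^esup>\<close> in the logarithm of the Euler product on the line with real part \<open>x\<close>.
\<close>

definition log_weight :: "nat \<Rightarrow> (nat \<Rightarrow> nat \<Rightarrow> int) \<Rightarrow> real \<Rightarrow> nat \<times> nat \<Rightarrow> real" where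
  "log_weight m \<alpha> x = (\<lambda>(p, r). \<Sum>l = 1..m.
     1 / real r * real_of_int (\<alpha> l p) ^ r * real p powr (- real r * x))"

text \<open>
  By unique factorisation distinct pairs give distinct prime powers, so this is a subseries of the
  convergent series of \<open>n\<^bsup>-x\<^esup>\<close>.
\<close>

lemma abs_summable_prime_powers:
  assumes "x > 1"
  shows "(\<lambda>(p, r). real p powr (- real r * x)) abs_summable_on prime_power_index"
proof -
  have inj: "inj_on (\<lambda>(p, r). p ^ r) prime_power_index"
    by (auto simp: inj_on_def prime_power_index_def prime_power_inj'')
  have "(\<lambda>n. real n powr (- x)) abs_summable_on ((\<lambda>(p, r). p ^ r) ` prime_power_index)"
    by (rule abs_summable_on_subset[of _ UNIV])
       (use assms summable_real_powr_iff[of "-x"] in \<open>auto simp: abs_summable_on_nat_iff'\<close>)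
  then have "(\<lambda>z. real (case z of (p, r) \<Rightarrow> p ^ r) powr (- x)) abs_summable_on prime_power_index"
    using abs_summable_on_reindex_iff[OF inj, of "\<lambda>n. real n powr (- x)"] by simp
  then show ?thesis
    by (rule abs_summable_on_comparison_test)
       (auto simp: powr_powr prime_power_index_def powr_realpow[symmetric] prime_gt_0_nat)
qed

lemma abs_summable_log_weight:
  assumes \<alpha>: "\<And>p l. prime p \<Longrightarrow> 1 \<le> l \<Longrightarrow> l \<le> m \<Longrightarrow> \<alpha> l p \<in> {-1, 0, 1}" and "x > 1"
  shows "log_weight m \<alpha> x abs_summable_on prime_power_index"
proof (rule abs_summable_on_comparison_test)
  show "(\<lambda>z. real m * (case z of (p, r) \<Rightarrow> real p powr (- real r * x))) abs_summable_on prime_power_index"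
    by (intro abs_summable_on_cmult_right abs_summable_prime_powers assms)
  fix z assume "z \<in> prime_power_index"
  then obtain p r where z: "z = (p, r)" and p: "prime p" and r: "r \<ge> 1"
    by (auto simp: prime_power_index_def)
  have "\<bar>1 / real r * real_of_int (\<alpha> l p) ^ r * real p powr (- real r * x)\<bar> \<le> real p powr (- real r * x)"
    if "l \<in> {1..m}" for l
  proof -
    have "\<bar>real_of_int (\<alpha> l p)\<bar> ^ r \<le> 1"
      using \<alpha>[OF p, of l] that by (intro power_le_one) auto
    then have "1 / real r * \<bar>real_of_int (\<alpha> l p)\<bar> ^ r \<le> 1 * 1"
      using r by (intro mult_mono) auto
    then have "1 / real r * \<bar>real_of_int (\<alpha> l p)\<bar> ^ r * real p powr (- real r * x) \<le> 1 * real p powr (- real r * x)"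
      by (intro mult_right_mono) auto
    then show ?thesis by (simp add: abs_mult power_abs)
  qed
  then have "\<bar>log_weight m \<alpha> x z\<bar> \<le> (\<Sum>l = 1..m. real p powr (- real r * x))"
    unfolding log_weight_def z prod.case by (intro order_trans[OF sum_abs] sum_mono)
  then show "norm (log_weight m \<alpha> x z) \<le> norm (real m * (case z of (p, r) \<Rightarrow> real p powr (- real r * x)))"
    by (simp add: z)
qed

text \<open>
  The series of the principal branch of \<open>- ln (1 - z)\<close>.
\<close>

lemma inverse_one_minus_exp_series:
  fixes z :: complex
  assumes "norm z < 1"
  shows "inverse (1 - z) = exp (\<Sum>\<^sub>ar\<in>{1..}. z ^ r / of_nat r)"
    and "(\<lambda>r. z ^ r / of_nat r) abs_summable_on {1..}"
proof -
  have "(\<lambda>r. norm z ^ r) abs_summable_on UNIV"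
    using assms by (simp add: abs_summable_on_nat_iff' summable_geometric)
  then have "(\<lambda>r. norm z ^ r) abs_summable_on {1..}"
    by (rule abs_summable_on_subset) auto
  then show 1: "(\<lambda>r. z ^ r / of_nat r) abs_summable_on {1..}"
  proof (rule abs_summable_on_comparison_test)
    fix r :: nat assume "r \<in> {1..}"
    then have "norm z ^ r / real r \<le> norm z ^ r / 1" by (intro divide_left_mono) auto
    then show "norm (z ^ r / of_nat r) \<le> norm (norm z ^ r)"
      by (simp add: norm_divide norm_power)
  qed
  have "(\<lambda>n. - ((z ^ n) / of_nat n)) sums ln (1 - z)"
    using Ln_series'[of "-z"] assms by simp
  then have "(\<lambda>n. z ^ n / of_nat n) sums (- ln (1 - z))"
    using sums_minus by fastforce
  also have "(\<lambda>n. z ^ n / of_nat n) = (\<lambda>n. if n \<in> {1..} then z ^ n / of_nat n else 0)"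
    by (auto simp: fun_eq_iff not_le)
  finally have "(\<Sum>\<^sub>ar\<in>{1..}. z ^ r / of_nat r) = - ln (1 - z)"
    using sums_infsetsum_nat[OF 1] sums_unique2 by blast
  moreover have "1 - z \<noteq> 0" using assms by auto
  ultimately show "inverse (1 - z) = exp (\<Sum>\<^sub>ar\<in>{1..}. z ^ r / of_nat r)"
    by (simp add: exp_minus)
qed

text \<open>
  Each local factor is the exponential of its logarithmic series; absolute convergence of the double
  series over \<open>p\<close> and \<open>r\<close> lets the product over primes pass into the exponent.
\<close>

lemma euler_product_eq_exp:
  fixes x u :: real
  assumes \<alpha>: "\<And>p l. prime p \<Longrightarrow> 1 \<le> l \<Longrightarrow> l \<le> m \<Longrightarrow> \<alpha> l p \<in> {-1, 0, 1}" and x: "x > 1"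
  shows "(\<Prod>p. if prime p
            then (\<Prod>l = 1..m. inverse (1 - of_int (\<alpha> l p) * of_nat p powr (- (of_real x + \<i> * of_real u))))
            else 1)
         = exp (\<Sum>\<^sub>az\<in>prime_power_index. log_weight m \<alpha> x z *\<^sub>R nat_character u (fst z ^ snd z))"
    (is "prodinf ?F = exp (infsetsum ?g _)")
proof -
  have sg: "?g abs_summable_on prime_power_index"
    by (intro abs_summable_character_weights bounded_character_nat_character
          abs_summable_log_weight[OF \<alpha> x])
  define G where "G p = (\<Sum>\<^sub>ar\<in>{1..}. ?g (p, r))" for p
  have sG: "G abs_summable_on {p. prime p}"
    unfolding G_def
    by (rule abs_summable_on_Sigma_project1') (use sg in \<open>auto simp: prime_power_index_def case_prod_unfold\<close>)
  have local_factor: "?F p = exp (if p \<in> {p. prime p} then G p else 0)" for p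
  proof (cases "prime p")
    case p: True
    define z where "z l = of_int (\<alpha> l p) * of_nat p powr (- (of_real x + \<i> * of_real u))" for l
    have p2: "real p > 1" using p prime_gt_1_nat by force
    have nz: "norm (z l) < 1" if "l \<in> {1..m}" for l
    proof -
      have "\<bar>real_of_int (\<alpha> l p)\<bar> \<le> 1" using \<alpha>[OF p, of l] that by auto
      then have "norm (z l) \<le> real p powr (-x)"
        using p2 by (simp add: z_def norm_mult norm_powr_real_powr mult_left_le_one_le)
      also have "\<dots> < 1" using p2 x by (simp add: powr_less_one)
      finally show ?thesis .
    qed
    have log_term: "?g (p, r) = (\<Sum>l=1..m. z l ^ r / of_nat r)" for r
    proof -
      have "(of_nat p powr (- (of_real x + \<i> * of_real u)) :: complex) ^ r
          = of_real (real p powr (- real r * x)) * nat_character u (p ^ r)"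
      proof -
        have "(of_nat p powr (- (of_real x + \<i> * of_real u)) :: complex) ^ r
            = exp (of_real (real r * (- x) * ln (real p)) + \<i> * of_real (- (u * (real r * ln (real p)))))"
          using p2 by (simp add: powr_def Ln_of_nat exp_of_nat_mult[symmetric] algebra_simps)
        also have "\<dots> = exp (of_real (real r * (- x) * ln (real p))) * iexp (- (u * (real r * ln (real p))))"
          by (rule exp_add)
        also have "iexp (- (u * (real r * ln (real p)))) = nat_character u (p ^ r)"
          using p2 by (simp add: nat_character_eq_iexp ln_realpow)
        also have "exp (of_real (real r * (- x) * ln (real p))) = (of_real (real p powr (- real r * x)) :: complex)"
          using p2 by (simp add: powr_def flip: exp_of_real)
        finally show ?thesis .
      qed
      then show ?thesis
        by (simp add: log_weight_def z_def power_mult_distrib scaleR_conv_of_real sum_distrib_left sum_distrib_right mult_ac)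
    qed
    have "?F p = (\<Prod>l=1..m. inverse (1 - z l))" using p by (simp add: z_def)
    also have "\<dots> = (\<Prod>l=1..m. exp (\<Sum>\<^sub>ar\<in>{1..}. z l ^ r / of_nat r))"
      by (intro prod.cong refl inverse_one_minus_exp_series nz)
    also have "\<dots> = exp (\<Sum>l=1..m. \<Sum>\<^sub>ar\<in>{1..}. z l ^ r / of_nat r)"
      by (simp add: exp_sum)
    also have "(\<Sum>l=1..m. \<Sum>\<^sub>ar\<in>{1..}. z l ^ r / of_nat r) = G p"
      unfolding G_def log_term by (intro sum_infsetsum inverse_one_minus_exp_series nz)
    finally show ?thesis using p by simp
  qed simp
  have "(\<lambda>p. if p \<in> {p. prime p} then G p else 0) sums infsetsum G {p. prime p}"
    by (rule sums_infsetsum_nat[OF sG])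
  then have "prodinf ?F = exp (infsetsum G {p. prime p})"
    unfolding local_factor by (simp add: prodinf_exp sums_iff)
  also have "infsetsum G {p. prime p} = infsetsum ?g prime_power_index"
    unfolding G_def prime_power_index_def
    by (rule infsetsum_Sigma[symmetric]) (use sg in \<open>auto simp: prime_power_index_def\<close>)
  finally show ?thesis .
qed

text \<open>
  At \<open>t = 0\<close> the characters equal 1 on prime powers, so dividing by the value there subtracts the total
  weight in the exponent. This is a formal compound Poisson representation whose weights may
  have either sign.
\<close>

lemma normalized_Z_eq_exp:
  fixes a \<sigma> t :: "real ^ 'd"
  assumes \<alpha>: "\<And>p l. prime p \<Longrightarrow> 1 \<le> l \<Longrightarrow> l \<le> m \<Longrightarrow> \<alpha> l p \<in> {-1, 0, 1}" and x: "a \<bullet> \<sigma> > 1"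
  shows "normalized_Z m \<alpha> a \<sigma> t =
    exp (\<Sum>\<^sub>az\<in>prime_power_index. log_weight m \<alpha> (a \<bullet> \<sigma>) z *\<^sub>R (nat_character (a \<bullet> t) (fst z ^ snd z) - 1))"
proof -
  have Z: "euler_Z m \<alpha> a (\<chi> j. complex_of_real (\<sigma> $ j) + \<i> * complex_of_real (t $ j)) =
      exp (\<Sum>\<^sub>az\<in>prime_power_index. log_weight m \<alpha> (a \<bullet> \<sigma>) z *\<^sub>R nat_character (a \<bullet> t) (fst z ^ snd z))" for t
  proof -
    have pairing: "pairing a (\<chi> j. complex_of_real (\<sigma> $ j) + \<i> * complex_of_real (t $ j)) =
        of_real (a \<bullet> \<sigma>) + \<i> * of_real (a \<bullet> t)"
      by (simp add: pairing_def inner_vec_def sum.distrib sum_distrib_left algebra_simps)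
    show ?thesis
      unfolding euler_Z_def pairing by (rule euler_product_eq_exp[OF \<alpha> x])
  qed
  have s: "(\<lambda>z. log_weight m \<alpha> (a \<bullet> \<sigma>) z *\<^sub>R nat_character u (fst z ^ snd z)) abs_summable_on prime_power_index" for u
    by (intro abs_summable_character_weights bounded_character_nat_character
          abs_summable_log_weight[OF \<alpha> x])
  have one: "log_weight m \<alpha> (a \<bullet> \<sigma>) z *\<^sub>R nat_character 0 (fst z ^ snd z) = log_weight m \<alpha> (a \<bullet> \<sigma>) z *\<^sub>R 1"
    if "z \<in> prime_power_index" for z
    using that by (auto simp: prime_power_index_def nat_character_def prime_gt_0_nat)
  have "normalized_Z m \<alpha> a \<sigma> t =
      exp ((\<Sum>\<^sub>az\<in>prime_power_index. log_weight m \<alpha> (a \<bullet> \<sigma>) z *\<^sub>R nat_character (a \<bullet> t) (fst z ^ snd z))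
         - (\<Sum>\<^sub>az\<in>prime_power_index. log_weight m \<alpha> (a \<bullet> \<sigma>) z *\<^sub>R nat_character 0 (fst z ^ snd z)))"
    using Z[of t] Z[of 0] by (simp add: normalized_Z_def exp_diff)
  also have "\<dots> = exp (\<Sum>\<^sub>az\<in>prime_power_index. log_weight m \<alpha> (a \<bullet> \<sigma>) z *\<^sub>R nat_character (a \<bullet> t) (fst z ^ snd z)
         - log_weight m \<alpha> (a \<bullet> \<sigma>) z *\<^sub>R nat_character 0 (fst z ^ snd z))"
    by (simp add: infsetsum_diff s)
  also have "\<dots> = exp (\<Sum>\<^sub>az\<in>prime_power_index. log_weight m \<alpha> (a \<bullet> \<sigma>) z *\<^sub>R (nat_character (a \<bullet> t) (fst z ^ snd z) - 1))"
    by (intro arg_cong[of _ _ exp] infsetsum_cong refl) (simp add: one scaleR_diff_right)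
  finally show ?thesis .
qed

section \<open>Compound Poisson laws on the line spanned by a vector\<close>

text \<open>
  On \<open>{-1, 0, 1}\<close> odd powers are the identity and even powers are nonnegative, so the hypothesis on
  the first powers controls all of them.
\<close>

lemma sum_powers_nonneg:
  fixes b :: "nat \<Rightarrow> int"
  assumes b: "\<And>l. l \<in> L \<Longrightarrow> b l \<in> {-1, 0, 1}" and "(\<Sum>l\<in>L. b l) \<ge> 0"
  shows "(\<Sum>l\<in>L. b l ^ r) \<ge> 0"
proof (cases "even r")
  case True then show ?thesis by (intro sum_nonneg) auto
next
  case False
  then have "b l ^ r = b l" if "l \<in> L" for l
    using b[OF that] by (auto simp: odd_pos)
  then have "(\<Sum>l\<in>L. b l ^ r) = (\<Sum>l\<in>L. b l)" by (intro sum.cong) auto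
  then show ?thesis using assms by simp
qed

lemma log_weight_eq:
  "log_weight m \<alpha> x (p, r) = real_of_int (\<Sum>l = 1..m. \<alpha> l p ^ r) * (real p powr (- real r * x) / real r)"
  by (simp add: log_weight_def sum_distrib_right sum_distrib_left mult_ac)

lemma log_weight_nonneg:
  assumes \<alpha>: "\<And>p l. prime p \<Longrightarrow> 1 \<le> l \<Longrightarrow> l \<le> m \<Longrightarrow> \<alpha> l p \<in> {-1, 0, 1}"
    and nonneg: "\<And>p. prime p \<Longrightarrow> (\<Sum>l = 1..m. \<alpha> l p) \<ge> 0"
    and z: "z \<in> prime_power_index"
  shows "log_weight m \<alpha> x z \<ge> 0"
proof -
  obtain p r where z': "z = (p, r)" "prime p" using z by (auto simp: prime_power_index_def)
  have "real_of_int (\<Sum>l = 1..m. \<alpha> l p ^ r) \<ge> 0"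
    unfolding of_int_0_le_iff by (rule sum_powers_nonneg) (use \<alpha>[OF z'(2)] nonneg[OF z'(2)] in auto)
  then show ?thesis unfolding z' log_weight_eq by (intro mult_nonneg_nonneg) auto
qed

text \<open>
  The minus sign makes the characteristic function at \<open>t\<close> the expectation of \<open>n\<^bsup>-i\<langle>a, t\<rangle>\<^esup>\<close>.
\<close>

definition log_law :: "real ^ 'd \<Rightarrow> nat pmf \<Rightarrow> (real ^ 'd) measure" where
  "log_law a P = distr (measure_pmf P) borel (\<lambda>n. - ln (real n) *\<^sub>R a)"

lemma prob_on_space_log_law: "prob_on_space (log_law a P)"
  unfolding prob_on_space_def log_law_def
  by (simp add: measure_pmf.prob_space_distr)

lemma char_vec_log_law:
  assumes "set_pmf P \<subseteq> {0<..}"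
  shows "char_vec (log_law a P) t = measure_pmf.expectation P (nat_character (a \<bullet> t))"
proof -
  have "char_vec (log_law a P) t = measure_pmf.expectation P (\<lambda>n. iexp (t \<bullet> (- ln (real n) *\<^sub>R a)))"
    unfolding char_vec_def log_law_def by (subst integral_distr) auto
  also have "\<dots> = measure_pmf.expectation P (nat_character (a \<bullet> t))"
  proof (intro integral_cong_AE)
    show "AE n in measure_pmf P. iexp (t \<bullet> (- ln (real n) *\<^sub>R a)) = nat_character (a \<bullet> t) n"
      using assms by (auto simp: AE_measure_pmf_iff nat_character_eq_iexp inner_commute mult_ac)
  qed auto
  finally show ?thesis .
qed

text \<open>
  The law is that of minus the logarithm, times \<open>a\<close>, of a Poisson product of prime powers. All
  prime powers lie in the submonoid of positive integers, so the value 0, where the logarithm fails to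
  be additive, has probability 0.
\<close>

lemma prime_power_law_exists:
  fixes a :: "real ^ 'd"
  assumes nonneg: "\<And>z. z \<in> prime_power_index \<Longrightarrow> v z \<ge> 0" and sum: "v abs_summable_on prime_power_index"
  shows "\<exists>\<mu>. prob_on_space \<mu> \<and> (\<forall>t. char_vec \<mu> t =
    exp (\<Sum>\<^sub>az\<in>prime_power_index. v z *\<^sub>R (nat_character (a \<bullet> t) (fst z ^ snd z) - 1)))"
proof -
  obtain P :: "nat pmf" where
    E: "\<And>h. bounded_character h \<Longrightarrow> measure_pmf.expectation P h =
       exp (\<Sum>\<^sub>az\<in>prime_power_index. v z *\<^sub>R (h (fst z ^ snd z) - 1))" and
    "\<And>M. 1 \<in> M \<Longrightarrow> (\<And>x y. x \<in> M \<Longrightarrow> y \<in> M \<Longrightarrow> x * y \<in> M) \<Longrightarrow>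
       (\<And>z. z \<in> prime_power_index \<Longrightarrow> v z > 0 \<Longrightarrow> fst z ^ snd z \<in> M) \<Longrightarrow> set_pmf P \<subseteq> M"
    by (rule compound_poisson_exists[where g = "\<lambda>z. fst z ^ snd z", OF nonneg sum]) blast+
  from this(2)[of "{0<..}"] have "set_pmf P \<subseteq> {0<..}"
    by (auto simp: prime_power_index_def prime_gt_0_nat)
  then show ?thesis
    using prob_on_space_log_law[of a P] E bounded_character_nat_character
    by (intro exI[of _ "log_law a P"]) (simp add: char_vec_log_law)
qed

text \<open>
  The \<open>n\<close>-th convolution root is the law of the same kind with all weights divided by \<open>n\<close>.
\<close>

lemma infinitely_divisible_prime_power_law:
  fixes a :: "real ^ 'd"
  assumes nonneg: "\<And>z. z \<in> prime_power_index \<Longrightarrow> v z \<ge> 0" and sum: "v abs_summable_on prime_power_index"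
    and \<mu>: "prob_on_space \<mu>"
    "\<And>t. char_vec \<mu> t = exp (\<Sum>\<^sub>az\<in>prime_power_index. v z *\<^sub>R (nat_character (a \<bullet> t) (fst z ^ snd z) - 1))"
  shows "infinitely_divisible \<mu>"
  unfolding infinitely_divisible_def
proof (intro conjI allI impI \<mu>(1))
  fix n :: nat assume n: "n \<ge> 1"
  have sum': "(\<lambda>z. (1 / real n) * v z) abs_summable_on prime_power_index"
    by (intro abs_summable_on_cmult_right sum)
  obtain \<mu>' where \<mu>': "prob_on_space \<mu>'"
    "\<And>t. char_vec \<mu>' t = exp (\<Sum>\<^sub>az\<in>prime_power_index. ((1 / real n) * v z) *\<^sub>R (nat_character (a \<bullet> t) (fst z ^ snd z) - 1))"
    using prime_power_law_exists[where a = a, OF _ sum'] nonneg by auto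
  have "char_vec \<mu> t = char_vec \<mu>' t ^ n" for t
  proof -
    have s: "(\<lambda>z. v z *\<^sub>R (nat_character (a \<bullet> t) (fst z ^ snd z) - 1)) abs_summable_on prime_power_index"
      by (rule abs_summable_character_weights(2)[OF bounded_character_nat_character sum])
    have "(\<Sum>\<^sub>az\<in>prime_power_index. ((1 / real n) * v z) *\<^sub>R (nat_character (a \<bullet> t) (fst z ^ snd z) - 1))
        = (1 / real n) *\<^sub>R (\<Sum>\<^sub>az\<in>prime_power_index. v z *\<^sub>R (nat_character (a \<bullet> t) (fst z ^ snd z) - 1))"
      unfolding scaleR_scaleR[symmetric] by (intro infsetsum_scaleR_right s)
    then show ?thesis
      using n by (simp add: \<mu> \<mu>' scaleR_conv_of_real flip: exp_of_nat_mult)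
  qed
  then show "\<exists>\<mu>'. prob_on_space \<mu>' \<and> (\<forall>t. char_vec \<mu> t = char_vec \<mu>' t ^ n)"
    using \<mu>' by blast
qed

lemma euler_N_eq:
  "euler_N m \<alpha> a \<sigma> = distr (point_measure prime_power_index (\<lambda>z. ennreal (log_weight m \<alpha> (a \<bullet> \<sigma>) z))) borel
     (\<lambda>z. ln (real (fst z ^ snd z)) *\<^sub>R a)"
proof -
  have "(\<lambda>z. ennreal (log_weight m \<alpha> (a \<bullet> \<sigma>) z)) = (\<lambda>(p, r). ennreal (\<Sum>l = 1..m.
             1 / real r * real_of_int (\<alpha> l p) ^ r * real p powr (- real r * (a \<bullet> \<sigma>))))"
    by (auto simp: log_weight_def fun_eq_iff)
  then show ?thesis
    unfolding euler_N_def prime_power_index_def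
    by (intro distr_cong) (auto simp: space_point_measure ln_realpow prime_gt_0_nat)
qed

section \<open>Purely atomic measures\<close>

text \<open>
  The points \<open>X z\<close> need not be distinct: weights at coinciding points add up.
\<close>

definition weighted_points :: "'i set \<Rightarrow> ('i \<Rightarrow> real) \<Rightarrow> ('i \<Rightarrow> real ^ 'd) \<Rightarrow> (real ^ 'd) measure" where
  "weighted_points A v X = distr (point_measure A (\<lambda>z. ennreal (v z))) borel X"

lemma sets_weighted_points [simp, measurable_cong]: "sets (weighted_points A v X) = sets borel"
  by (simp add: weighted_points_def)

lemma reflect_weighted_points: "reflect (weighted_points A v X) = weighted_points A v (\<lambda>z. - X z)"
  unfolding reflect_def weighted_points_def by (subst distr_distr) (auto simp: comp_def)

lemma integral_weighted_points:
  fixes f :: "real ^ 'd \<Rightarrow> 'b::{banach, second_countable_topology}"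
  assumes "\<And>z. z \<in> A \<Longrightarrow> v z \<ge> 0" and f: "f \<in> borel_measurable borel"
  shows "integral\<^sup>L (weighted_points A v X) f = (\<Sum>\<^sub>az\<in>A. v z *\<^sub>R f (X z))"
  unfolding weighted_points_def point_measure_def infsetsum_def
  using assms by (simp add: integral_distr integral_density AE_count_space)

lemma emeasure_weighted_points:
  assumes "B \<in> sets borel"
  shows "emeasure (weighted_points A v X) B = (\<integral>\<^sup>+z. ennreal (v z) * indicator B (X z) \<partial>count_space A)"
proof -
  have "emeasure (weighted_points A v X) B = (\<integral>\<^sup>+x. indicator B x \<partial>weighted_points A v X)"
    using assms by simp
  also have "\<dots> = (\<integral>\<^sup>+z. ennreal (v z) * indicator B (X z) \<partial>count_space A)"
    unfolding weighted_points_def point_measure_def using assms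
    by (simp add: nn_integral_distr nn_integral_density del: nn_integral_indicator)
  finally show ?thesis .
qed

lemma emeasure_weighted_points_space:
  assumes "\<And>z. z \<in> A \<Longrightarrow> v z \<ge> 0" and "v abs_summable_on A"
  shows "emeasure (weighted_points A v X) UNIV = ennreal (infsetsum v A)"
  using assms by (simp add: emeasure_weighted_points nn_integral_conv_infsetsum)

lemma finite_measure_weighted_points:
  assumes "\<And>z. z \<in> A \<Longrightarrow> v z \<ge> 0" and "v abs_summable_on A"
  shows "finite_measure (weighted_points A v X)"
  by (rule finite_measureI)
     (use emeasure_weighted_points_space[OF assms, of X] in \<open>simp add: weighted_points_def\<close>)

lemma emeasure_weighted_points_eq_0:
  assumes "\<And>z. z \<in> A \<Longrightarrow> X z \<noteq> x"
  shows "emeasure (weighted_points A v X) {x} = 0"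
  using assms by (simp add: emeasure_weighted_points nn_integral_0_iff_AE AE_count_space indicator_def)

text \<open>
  The rate is the total mass and the jump law is the normalised measure.
\<close>

lemma compound_poisson_weighted_points:
  fixes X :: "'i \<Rightarrow> real ^ 'd"
  assumes nonneg: "\<And>z. z \<in> A \<Longrightarrow> v z \<ge> 0" and sum: "v abs_summable_on A"
    and pos: "\<exists>z\<in>A. v z > 0" and X: "\<And>z. z \<in> A \<Longrightarrow> X z \<noteq> 0"
  shows "is_compound_poisson_char_fun (\<lambda>t. exp (\<Sum>\<^sub>az\<in>A. v z *\<^sub>R (iexp (t \<bullet> X z) - 1)))"
proof -
  define c where "c = infsetsum v A"
  from pos obtain z0 where z0: "z0 \<in> A" "v z0 > 0" by auto
  have "v z0 = infsetsum v {z0}" by simp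
  also have "\<dots> \<le> c" unfolding c_def
    by (rule infsetsum_mono_neutral_left) (use z0 sum nonneg in auto)
  finally have c: "c > 0" using z0 by simp
  define w where "w z = (1 / c) * v z" for z
  have w: "\<And>z. z \<in> A \<Longrightarrow> w z \<ge> 0" "w abs_summable_on A"
    unfolding w_def using c nonneg by (simp, intro abs_summable_on_cmult_right sum)
  have w1: "infsetsum w A = 1"
    unfolding w_def using c by (subst infsetsum_cmult_right) (auto simp: sum c_def)
  define \<rho> where "\<rho> = weighted_points A w X"
  have "prob_space \<rho>"
    unfolding \<rho>_def
    by (rule prob_spaceI) (use emeasure_weighted_points_space[OF w, of X] w1 in \<open>simp add: weighted_points_def\<close>)
  then have \<rho>: "prob_on_space \<rho>" by (simp add: prob_on_space_def \<rho>_def)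
  have "(\<Sum>\<^sub>az\<in>A. v z *\<^sub>R (iexp (t \<bullet> X z) - 1)) = of_real c * (char_vec \<rho> t - 1)" for t
  proof -
    have s: "(\<lambda>z. w z *\<^sub>R iexp (t \<bullet> X z)) abs_summable_on A"
      by (rule abs_summable_on_comparison_test[OF w(2)]) simp
    have s1: "(\<lambda>z. w z *\<^sub>R (1::complex)) abs_summable_on A"
      by (rule abs_summable_on_comparison_test[OF w(2)]) simp
    have "char_vec \<rho> t - 1 = (\<Sum>\<^sub>az\<in>A. w z *\<^sub>R iexp (t \<bullet> X z)) - (\<Sum>\<^sub>az\<in>A. w z *\<^sub>R (1::complex))"
      unfolding char_vec_def \<rho>_def using w1
      by (subst integral_weighted_points[OF w(1)]) (auto simp: scaleR_conv_of_real infsetsum_of_real)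
    also have "\<dots> = (\<Sum>\<^sub>az\<in>A. w z *\<^sub>R (iexp (t \<bullet> X z) - 1))"
      unfolding scaleR_diff_right by (rule infsetsum_diff[symmetric, OF s s1])
    finally have "of_real c * (char_vec \<rho> t - 1) = c *\<^sub>R (\<Sum>\<^sub>az\<in>A. w z *\<^sub>R (iexp (t \<bullet> X z) - 1))"
      by (simp add: scaleR_conv_of_real)
    also have "\<dots> = (\<Sum>\<^sub>az\<in>A. c *\<^sub>R (w z *\<^sub>R (iexp (t \<bullet> X z) - 1)))"
      using abs_summable_on_diff[OF s s1]
      unfolding scaleR_diff_right[of "w _", symmetric] by (intro infsetsum_scaleR_right[symmetric])
    finally show ?thesis using c by (simp add: w_def)
  qed
  moreover have "emeasure \<rho> {0} = 0"
    unfolding \<rho>_def by (intro emeasure_weighted_points_eq_0 X)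
  ultimately show ?thesis
    unfolding is_compound_poisson_char_fun_def using c \<rho> by auto
qed

text \<open>
  For a finite measure the compensating term \<open>x / (1 + |x|\<^sup>2)\<close> is integrable by itself; its integral is
  the drift \<open>\<gamma>\<close> that cancels the compensation, and there is no Gaussian part.
\<close>

lemma is_levy_measure_finite:
  fixes \<mu> \<nu> :: "(real ^ 'd) measure"
  assumes inf: "infinitely_divisible \<mu>" and \<nu>: "finite_measure \<nu>" "sets \<nu> = sets borel" "emeasure \<nu> {0} = 0"
    and char: "\<And>t. char_vec \<mu> t = exp (CLINT x|\<nu>. iexp (t \<bullet> x) - 1)"
  shows "is_levy_measure \<mu> \<nu>"
proof -
  interpret finite_measure \<nu> by fact
  note [measurable_cong] = \<nu>(2)
  have le: "norm x / (1 + (norm x)\<^sup>2) \<le> 1" for x :: "real ^ 'd"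
  proof -
    have "0 \<le> (norm x - 1)\<^sup>2 + 1 + (norm x)\<^sup>2" by simp
    also have "\<dots> = 2 * (1 + (norm x)\<^sup>2 - norm x)" by (simp add: power2_eq_square algebra_simps)
    finally show ?thesis by (simp add: divide_le_eq add_pos_nonneg)
  qed
  define k where "k x = (1 / (1 + (norm x)\<^sup>2)) *\<^sub>R x" for x :: "real ^ 'd"
  have "k \<in> borel_measurable borel"
    unfolding k_def
    by (intro borel_measurable_continuous_onI continuous_intros) (simp add: add_nonneg_eq_0_iff)
  then have [measurable]: "k \<in> borel_measurable \<nu>" by measurable
  have k: "integrable \<nu> k"
    by (rule integrable_const_bound[where B = 1]) (use le in \<open>auto simp: k_def abs_of_nonneg\<close>)
  define \<gamma> where "\<gamma> = integral\<^sup>L \<nu> k"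
  have "(\<integral>\<^sup>+ x. ennreal (min ((norm x)\<^sup>2) 1) \<partial>\<nu>) \<le> (\<integral>\<^sup>+ x. 1 \<partial>\<nu>)"
    by (intro nn_integral_mono) auto
  also have "\<dots> < \<infinity>" using emeasure_finite by (simp add: less_top[symmetric])
  finally have fin: "(\<integral>\<^sup>+ x. ennreal (min ((norm x)\<^sup>2) 1) \<partial>\<nu>) < \<infinity>" .
  have "char_vec \<mu> t = exp (- complex_of_real (t \<bullet> (0 *v t)) / 2 + \<i> * complex_of_real (\<gamma> \<bullet> t)
             + (CLINT x|\<nu>. iexp (t \<bullet> x) - 1
                  - \<i> * complex_of_real (t \<bullet> x) / complex_of_real (1 + (norm x)\<^sup>2)))" for t
  proof -
    have i1: "integrable \<nu> (\<lambda>x. iexp (t \<bullet> x) - 1)"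
      by (rule integrable_const_bound[where B = 2])
         (auto intro!: order_trans[OF norm_triangle_ineq4])
    have i2: "integrable \<nu> (\<lambda>x. complex_of_real (k x \<bullet> t))"
      using k by (intro integrable_of_real integrable_inner_left) auto
    have "(CLINT x|\<nu>. iexp (t \<bullet> x) - 1 - \<i> * complex_of_real (t \<bullet> x) / complex_of_real (1 + (norm x)\<^sup>2))
        = (CLINT x|\<nu>. (iexp (t \<bullet> x) - 1) - \<i> * complex_of_real (k x \<bullet> t))"
      by (intro Bochner_Integration.integral_cong refl) (simp add: k_def inner_commute)
    also have "\<dots> = (CLINT x|\<nu>. iexp (t \<bullet> x) - 1) - \<i> * (CLINT x|\<nu>. complex_of_real (k x \<bullet> t))"
      using i1 i2 by simp
    also have "(CLINT x|\<nu>. complex_of_real (k x \<bullet> t)) = complex_of_real (\<gamma> \<bullet> t)"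
      unfolding \<gamma>_def using k by simp
    finally show ?thesis by (simp add: char)
  qed
  moreover have "transpose (0 :: real ^ 'd ^ 'd) = 0" by (simp add: transpose_def vec_eq_iff)
  ultimately show ?thesis
    unfolding is_levy_measure_def using inf \<nu> fin
    by (intro conjI exI[of _ "0 :: real ^ 'd ^ 'd"] exI[of _ \<gamma>]) auto
qed

section \<open>Necessity of nonnegative weights at primes\<close>

lemma char_convolution:
  assumes "real_distribution M" "real_distribution N"
  shows "char (convolution M N) t = char M t * char N t"
proof -
  interpret M: real_distribution M by fact
  interpret N: real_distribution N by fact
  interpret pair_prob_space M N ..
  have int: "integrable (M \<Otimes>\<^sub>M N) (\<lambda>z. iexp (t * (fst z + snd z)))"
    by (rule P.integrable_const_bound[where B = 1]) auto
  have "char (convolution M N) t = (CLINT z|M \<Otimes>\<^sub>M N. iexp (t * (fst z + snd z)))"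
    unfolding char_def convolution_def by (subst integral_distr) (auto simp: case_prod_unfold)
  also have "\<dots> = (CLINT x|M. CLINT y|N. iexp (t * (x + y)))"
    using integral_fst'[OF int] by simp
  also have "\<dots> = (CLINT x|M. iexp (t * x) * (CLINT y|N. iexp (t * y)))"
    by (intro Bochner_Integration.integral_cong refl) (simp add: exp_add algebra_simps)
  also have "\<dots> = char M t * char N t" by (simp add: char_def)
  finally show ?thesis .
qed

lemma emeasure_distr_pmf_eq_0_iff:
  fixes f :: "'a \<Rightarrow> real"
  assumes "A \<in> sets borel"
  shows "emeasure (distr (measure_pmf P) borel f) A = 0 \<longleftrightarrow> (\<forall>n\<in>set_pmf P. f n \<notin> A)"
  using assms
  by (auto simp: emeasure_distr measure_pmf.emeasure_eq_measure measure_pmf_zero_iff)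

text \<open>
  A sum of independent variables avoids \<open>A\<close> almost surely iff almost every value of the first avoids
  it together with every atom of the second. This reduces statements about convolutions to statements
  about supports.
\<close>

lemma convolution_pmf_null_iff:
  fixes f :: "'a \<Rightarrow> real"
  assumes "real_distribution M" and A[measurable]: "A \<in> sets borel"
  shows "emeasure (convolution M (distr (measure_pmf Q) borel f)) A = 0 \<longleftrightarrow>
           (AE x in M. \<forall>n\<in>set_pmf Q. f n + x \<notin> A)"
proof -
  interpret M: real_distribution M by fact
  interpret Q: real_distribution "distr (measure_pmf Q) borel f"
    by (simp add: prob_space.real_distribution_distr[OF prob_space_measure_pmf])
  have "emeasure (convolution M (distr (measure_pmf Q) borel f)) A =
      (\<integral>\<^sup>+x. emeasure (distr (measure_pmf Q) borel f) {y. y + x \<in> A} \<partial>M)"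
    by (rule convolution_emeasure) (auto intro: M.finite_measure_axioms Q.finite_measure_axioms)
  also have "\<dots> = 0 \<longleftrightarrow> (AE x in M. emeasure (distr (measure_pmf Q) borel f) {y. y + x \<in> A} = 0)"
  proof (rule nn_integral_0_iff_AE)
    have "(\<lambda>x. emeasure (distr (measure_pmf Q) borel f) (Pair x -` {z \<in> space (borel \<Otimes>\<^sub>M borel). snd z + fst z \<in> A})) \<in> borel_measurable borel"
      by (rule Q.measurable_emeasure_Pair) (simp, measurable)
    then show "(\<lambda>x. emeasure (distr (measure_pmf Q) borel f) {y. y + x \<in> A}) \<in> borel_measurable M"
      by (simp add: vimage_def space_pair_measure)
  qed
  also have "\<dots> \<longleftrightarrow> (AE x in M. \<forall>n\<in>set_pmf Q. f n + x \<notin> A)"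
    by (intro AE_cong) (subst emeasure_distr_pmf_eq_0_iff, auto)
  finally show ?thesis .
qed

lemma char_log_pmf:
  assumes "set_pmf P \<subseteq> {0<..}"
  shows "char (distr (measure_pmf P) borel (\<lambda>n. ln (real n))) u = measure_pmf.expectation P (nat_character (- u))"
proof -
  have "char (distr (measure_pmf P) borel (\<lambda>n. ln (real n))) u = measure_pmf.expectation P (\<lambda>n. iexp (u * ln (real n)))"
    unfolding char_def by (subst integral_distr) auto
  also have "\<dots> = measure_pmf.expectation P (nat_character (- u))"
  proof (intro integral_cong_AE)
    show "AE n in measure_pmf P. iexp (u * ln (real n)) = nat_character (- u) n"
      using assms by (auto simp: AE_measure_pmf_iff nat_character_eq_iexp)
  qed auto
  finally show ?thesis .
qed

text \<open>
  Split the weights into positive and negative parts, and let \<open>P\<close> and \<open>Q\<close> be the corresponding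
  random integers, Poisson products of prime powers. Let \<open>\<nu>\<close> be the image of \<open>\<mu>\<close> on the line spanned
  by \<open>a\<close>, oriented so that \<open>log n\<close> stands for \<open>n\<close>. The hypothesis says that the convolution of \<open>\<nu>\<close>
  with the law of \<open>log Q\<close> is the law of \<open>log P\<close>. Suppose that the weight at \<open>q\<close> is negative. The
  positive integers other than the prime \<open>q\<close> form a submonoid, and it contains all jumps of \<open>P\<close>; hence
  \<open>P\<close> never equals \<open>q\<close>, whereas \<open>Q\<close> equals \<open>q\<close> with positive probability. So \<open>\<nu>\<close> has no atom at 0.
  Since \<open>log P \<ge> 0\<close> and \<open>Q = 1\<close> has positive probability, \<open>\<nu>\<close> lives on \<open>[0, \<infinity>)\<close>, and therefore on
  \<open>(0, \<infinity>)\<close>. Then \<open>log P > 0\<close> almost surely, which contradicts that \<open>P = 1\<close> has positive probability.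
\<close>

lemma weight_at_prime_nonneg:
  fixes a :: "real ^ 'd"
  assumes W: "W abs_summable_on prime_power_index" and a: "a \<noteq> 0" and q: "prime q"
    and \<mu>: "prob_on_space \<mu>"
    and char: "\<And>t. char_vec \<mu> t =
      exp (\<Sum>\<^sub>az\<in>prime_power_index. W z *\<^sub>R (nat_character (a \<bullet> t) (fst z ^ snd z) - 1))"
  shows "W (q, 1) \<ge> 0"
proof (rule ccontr)
  assume neg: "\<not> W (q, 1) \<ge> 0"
  define v\<^sub>p where "v\<^sub>p z = max (W z) 0" for z
  define v\<^sub>n where "v\<^sub>n z = max (- W z) 0" for z
  have nonneg: "v\<^sub>p z \<ge> 0" "v\<^sub>n z \<ge> 0" for z by (auto simp: v\<^sub>p_def v\<^sub>n_def)
  have vp: "v\<^sub>p abs_summable_on prime_power_index" and vn: "v\<^sub>n abs_summable_on prime_power_index"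
    by (auto intro!: abs_summable_on_comparison_test[OF W] simp: v\<^sub>p_def v\<^sub>n_def)
  let ?g = "\<lambda>z :: nat \<times> nat. fst z ^ snd z"
  obtain P :: "nat pmf" where
    EP: "\<And>h. bounded_character h \<Longrightarrow> measure_pmf.expectation P h =
       exp (\<Sum>\<^sub>az\<in>prime_power_index. v\<^sub>p z *\<^sub>R (h (?g z) - 1))" and
    P1: "1 \<in> set_pmf P" and
    subP: "\<And>M. 1 \<in> M \<Longrightarrow> (\<And>x y. x \<in> M \<Longrightarrow> y \<in> M \<Longrightarrow> x * y \<in> M) \<Longrightarrow>
       (\<And>z. z \<in> prime_power_index \<Longrightarrow> v\<^sub>p z > 0 \<Longrightarrow> ?g z \<in> M) \<Longrightarrow> set_pmf P \<subseteq> M"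
    by (rule compound_poisson_exists[where g = ?g, OF nonneg(1) vp]) blast+
  obtain Q :: "nat pmf" where
    EQ: "\<And>h. bounded_character h \<Longrightarrow> measure_pmf.expectation Q h =
       exp (\<Sum>\<^sub>az\<in>prime_power_index. v\<^sub>n z *\<^sub>R (h (?g z) - 1))" and
    Q1: "1 \<in> set_pmf Q" and
    Qmem: "\<And>z. z \<in> prime_power_index \<Longrightarrow> v\<^sub>n z > 0 \<Longrightarrow> ?g z \<in> set_pmf Q" and
    subQ: "\<And>M. 1 \<in> M \<Longrightarrow> (\<And>x y. x \<in> M \<Longrightarrow> y \<in> M \<Longrightarrow> x * y \<in> M) \<Longrightarrow>
       (\<And>z. z \<in> prime_power_index \<Longrightarrow> v\<^sub>n z > 0 \<Longrightarrow> ?g z \<in> M) \<Longrightarrow> set_pmf Q \<subseteq> M"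
    by (rule compound_poisson_exists[where g = ?g, OF nonneg(2) vn]) blast+
  have posQ: "set_pmf Q \<subseteq> {0<..}"
    by (rule subQ) (auto simp: prime_power_index_def prime_gt_0_nat)
  have "set_pmf P \<subseteq> {n. n > 0 \<and> n \<noteq> q}"
  proof (rule subP)
    show "1 \<in> {n. n > 0 \<and> n \<noteq> q}" using q by auto
    show "x * y \<in> {n. n > 0 \<and> n \<noteq> q}" if "x \<in> {n. n > 0 \<and> n \<noteq> q}" "y \<in> {n. n > 0 \<and> n \<noteq> q}" for x y
      using that q prime_product[of x y] by auto
    show "?g z \<in> {n. n > 0 \<and> n \<noteq> q}" if z: "z \<in> prime_power_index" "v\<^sub>p z > 0" for z
    proof -
      obtain p r where pr: "z = (p, r)" "prime p" "r \<ge> 1" using z(1) by (auto simp: prime_power_index_def)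
      have "p ^ r \<noteq> q"
      proof
        assume "p ^ r = q"
        then have "p = q" "r = 1" using prime_power_inj'[OF pr(2) q, of r 1] pr(3) by auto
        then show False using z(2) neg by (simp add: pr(1) v\<^sub>p_def)
      qed
      then show ?thesis using pr by (simp add: prime_gt_0_nat)
    qed
  qed
  then have posP: "set_pmf P \<subseteq> {0<..}" and qP: "q \<notin> set_pmf P" by auto
  have qQ: "q \<in> set_pmf Q"
    using Qmem[of "(q, 1)"] q neg by (simp add: prime_power_index_def v\<^sub>n_def)
  \<comment> \<open>Moving the negative part to the other side leaves two genuine characteristic functions.\<close>
  have factor: "char_vec \<mu> t * measure_pmf.expectation Q (nat_character (a \<bullet> t)) =
      measure_pmf.expectation P (nat_character (a \<bullet> t))" for t
  proof -
    define h where "h = nat_character (a \<bullet> t)"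
    have h: "bounded_character h" unfolding h_def by (rule bounded_character_nat_character)
    have s: "(\<lambda>z. v z *\<^sub>R (h (?g z) - 1)) abs_summable_on prime_power_index"
      if "v abs_summable_on prime_power_index" for v :: "nat \<times> nat \<Rightarrow> real"
      by (rule abs_summable_character_weights(2)[OF h that])
    have "(\<Sum>\<^sub>az\<in>prime_power_index. W z *\<^sub>R (h (?g z) - 1)) + (\<Sum>\<^sub>az\<in>prime_power_index. v\<^sub>n z *\<^sub>R (h (?g z) - 1))
        = (\<Sum>\<^sub>az\<in>prime_power_index. W z *\<^sub>R (h (?g z) - 1) + v\<^sub>n z *\<^sub>R (h (?g z) - 1))"
      by (rule infsetsum_add[symmetric, OF s[OF W] s[OF vn]])
    also have "\<dots> = (\<Sum>\<^sub>az\<in>prime_power_index. v\<^sub>p z *\<^sub>R (h (?g z) - 1))"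
      by (intro infsetsum_cong refl) (simp add: v\<^sub>p_def v\<^sub>n_def max_def flip: scaleR_left_distrib)
    finally show ?thesis
      unfolding char h_def[symmetric] EP[OF h] EQ[OF h] by (simp flip: exp_add)
  qed
  \<comment> \<open>The coordinate along \<open>a\<close>, with the sign reversed because the jumps are at \<open>- log n \<cdot> a\<close>.\<close>
  define \<nu> where "\<nu> = distr \<mu> borel (\<lambda>x. - (x \<bullet> a) / (a \<bullet> a))"
  define DP where "DP = distr (measure_pmf P) borel (\<lambda>n. ln (real n))"
  define DQ where "DQ = distr (measure_pmf Q) borel (\<lambda>n. ln (real n))"
  interpret \<mu>: prob_space \<mu> using \<mu> by (simp add: prob_on_space_def)
  have [measurable_cong]: "sets \<mu> = sets borel" using \<mu> by (simp add: prob_on_space_def)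
  have rd: "real_distribution \<nu>" "real_distribution DP" "real_distribution DQ"
    unfolding \<nu>_def DP_def DQ_def by (simp_all add: prob_space.real_distribution_distr[OF prob_space_measure_pmf] \<mu>.real_distribution_distr)
  interpret \<nu>: real_distribution \<nu> by (rule rd)
  interpret DQ: real_distribution DQ by (rule rd)
  interpret pair_prob_space \<nu> DQ ..
  have "char (convolution \<nu> DQ) u = char DP u" for u
  proof -
    have "char \<nu> u = char_vec \<mu> ((- u / (a \<bullet> a)) *\<^sub>R a)"
      unfolding char_def \<nu>_def char_vec_def by (subst integral_distr) (auto simp: inner_commute)
    moreover have "a \<bullet> ((- u / (a \<bullet> a)) *\<^sub>R a) = - u" using a by simp
    ultimately show ?thesis
      using factor[of "(- u / (a \<bullet> a)) *\<^sub>R a"] posP posQ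
      by (simp add: char_convolution rd DP_def DQ_def[symmetric] char_log_pmf)
         (simp add: DQ_def char_log_pmf)
  qed
  moreover have "real_distribution (convolution \<nu> DQ)"
    unfolding convolution_def by (rule P.real_distribution_distr) simp
  ultimately have conv: "convolution \<nu> DQ = DP"
    using Levy_uniqueness rd(2) by blast
  have null: "(\<forall>n\<in>set_pmf P. ln (real n) \<notin> A) \<longleftrightarrow> (AE x in \<nu>. \<forall>n\<in>set_pmf Q. ln (real n) + x \<notin> A)"
    if "A \<in> sets borel" for A
  proof -
    have "(\<forall>n\<in>set_pmf P. ln (real n) \<notin> A) \<longleftrightarrow> emeasure (convolution \<nu> DQ) A = 0"
      unfolding conv DP_def by (rule emeasure_distr_pmf_eq_0_iff[OF that, symmetric])
    also have "\<dots> \<longleftrightarrow> (AE x in \<nu>. \<forall>n\<in>set_pmf Q. ln (real n) + x \<notin> A)"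
      unfolding DQ_def by (rule convolution_pmf_null_iff[OF rd(1) that])
    finally show ?thesis .
  qed
  have "\<forall>n\<in>set_pmf P. ln (real n) \<notin> {ln (real q)}"
    using posP qP q by (auto simp: prime_gt_0_nat)
  then have "AE x in \<nu>. x \<noteq> 0"
    using qQ by (subst (asm) null) (auto elim!: eventually_mono)
  moreover have "\<forall>n\<in>set_pmf P. ln (real n) \<notin> {..<0}"
    using posP by (auto simp: not_less Suc_le_eq)
  then have "AE x in \<nu>. x \<ge> 0"
    using Q1 by (subst (asm) null) (auto elim!: eventually_mono simp: not_less)
  ultimately have "AE x in \<nu>. \<forall>n\<in>set_pmf Q. ln (real n) + x \<notin> {0}"
  proof eventually_elim
    case (elim x)
    have "ln (real n) + x > 0" if "n \<in> set_pmf Q" for n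
    proof -
      have "n \<ge> 1" using posQ that by (auto simp: Suc_le_eq)
      then have "ln (real n) \<ge> 0" by simp
      with elim show ?thesis by linarith
    qed
    then show ?case by force
  qed
  then have "\<forall>n\<in>set_pmf P. ln (real n) \<notin> {0}"
    by (subst null) auto
  then show False using P1 by force
qed

section \<open>Characteristic functions of finite Euler products\<close>

theorem theorem3p1:
  fixes a \<sigma> :: "real ^ 'd"
    and m :: nat
    and \<alpha> :: "nat \<Rightarrow> nat \<Rightarrow> int"
  assumes "\<And>p l. prime p \<Longrightarrow> 1 \<le> l \<Longrightarrow> l \<le> m \<Longrightarrow> \<alpha> l p \<in> {-1, 0, 1}"
    and "a \<bullet> \<sigma> > 1"
  shows "(is_char_fun (normalized_Z m \<alpha> a \<sigma>) \<longleftrightarrow>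
            (\<forall>p. prime p \<longrightarrow> (\<Sum>l = 1..m. \<alpha> l p) \<ge> 0))
       \<and> ((\<forall>p. prime p \<longrightarrow> (\<Sum>l = 1..m. \<alpha> l p) \<ge> 0) \<longrightarrow>
            ((\<exists>p l. prime p \<and> 1 \<le> l \<and> l \<le> m \<and> \<alpha> l p \<noteq> 0) \<longrightarrow>
               is_compound_poisson_char_fun (normalized_Z m \<alpha> a \<sigma>))
          \<and> finite_measure (euler_N m \<alpha> a \<sigma>)
          \<and> (\<exists>\<mu>. prob_on_space \<mu>
                \<and> (\<forall>t. normalized_Z m \<alpha> a \<sigma> t = char_vec \<mu> t)
                \<and> is_levy_measure \<mu> (reflect (euler_N m \<alpha> a \<sigma>))))"
proof -
  define W where "W = log_weight m \<alpha> (a \<bullet> \<sigma>)"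
  define X where "X z = ln (real (fst z ^ snd z)) *\<^sub>R a" for z :: "nat \<times> nat"
  have a: "a \<noteq> 0" using assms(2) by auto
  have W: "W abs_summable_on prime_power_index"
    unfolding W_def by (rule abs_summable_log_weight[OF assms])
  have Z: "normalized_Z m \<alpha> a \<sigma> t =
      exp (\<Sum>\<^sub>az\<in>prime_power_index. W z *\<^sub>R (nat_character (a \<bullet> t) (fst z ^ snd z) - 1))" for t
    unfolding W_def by (rule normalized_Z_eq_exp[OF assms])
  have ZX: "normalized_Z m \<alpha> a \<sigma> t = exp (\<Sum>\<^sub>az\<in>prime_power_index. W z *\<^sub>R (iexp (t \<bullet> - X z) - 1))" for t
    unfolding Z
    by (intro arg_cong[of _ _ exp] infsetsum_cong refl arg_cong2[of _ _ _ _ "(*\<^sub>R)"] arg_cong2[of _ _ _ _ minus])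
       (auto simp: prime_power_index_def prime_gt_0_nat nat_character_eq_iexp X_def inner_commute mult_ac)
  have X0: "- X z \<noteq> 0" if z: "z \<in> prime_power_index" for z
  proof -
    obtain p r where pr: "z = (p, r)" "prime p" "r \<ge> 1" using z by (auto simp: prime_power_index_def)
    then have "1 < p ^ r" using prime_gt_1_nat[of p] by (intro one_less_power) auto
    then have "ln (real (p ^ r)) > 0" by (metis ln_gt_zero of_nat_1 of_nat_less_iff)
    then show ?thesis using a by (simp add: X_def pr)
  qed
  have N: "euler_N m \<alpha> a \<sigma> = weighted_points prime_power_index W X"
    unfolding W_def X_def weighted_points_def by (rule euler_N_eq)

  have necessary: "(\<Sum>l = 1..m. \<alpha> l p) \<ge> 0" if char: "is_char_fun (normalized_Z m \<alpha> a \<sigma>)" and p: "prime p" for p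
  proof -
    obtain \<mu> where \<mu>: "prob_on_space \<mu>" "\<And>t. char_vec \<mu> t = normalized_Z m \<alpha> a \<sigma> t"
      using char unfolding is_char_fun_def by metis
    have "W (p, 1) \<ge> 0"
      by (rule weight_at_prime_nonneg[OF W a p \<mu>(1)]) (simp add: \<mu> Z)
    then have "real_of_int (\<Sum>l = 1..m. \<alpha> l p) \<ge> 0"
      using p prime_gt_0_nat[OF p] by (simp add: W_def log_weight_eq zero_le_mult_iff del: of_int_sum)
    then show ?thesis by (simp only: of_int_0_le_iff)
  qed

  have sufficient: "((\<exists>p l. prime p \<and> 1 \<le> l \<and> l \<le> m \<and> \<alpha> l p \<noteq> 0) \<longrightarrow>
               is_compound_poisson_char_fun (normalized_Z m \<alpha> a \<sigma>))
          \<and> finite_measure (euler_N m \<alpha> a \<sigma>)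
          \<and> (\<exists>\<mu>. prob_on_space \<mu>
                \<and> (\<forall>t. normalized_Z m \<alpha> a \<sigma> t = char_vec \<mu> t)
                \<and> is_levy_measure \<mu> (reflect (euler_N m \<alpha> a \<sigma>)))"
    if nonneg: "\<forall>p. prime p \<longrightarrow> (\<Sum>l = 1..m. \<alpha> l p) \<ge> 0"
  proof (intro conjI impI)
    have W_nonneg: "W z \<ge> 0" if "z \<in> prime_power_index" for z
      unfolding W_def using assms(1) nonneg that by (intro log_weight_nonneg) auto
    show "finite_measure (euler_N m \<alpha> a \<sigma>)"
      unfolding N by (rule finite_measure_weighted_points[OF W_nonneg W])
    show "is_compound_poisson_char_fun (normalized_Z m \<alpha> a \<sigma>)"
      if "\<exists>p l. prime p \<and> 1 \<le> l \<and> l \<le> m \<and> \<alpha> l p \<noteq> 0"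
    proof -
      from that obtain p l where pl: "prime p" "1 \<le> l" "l \<le> m" "\<alpha> l p \<noteq> 0" by auto
      \<comment> \<open>At \<open>r = 1\<close> the coefficients may cancel, so positivity of some weight is read off at \<open>r = 2\<close>.\<close>
      have "(\<Sum>l = 1..m. \<alpha> l p ^ 2) > 0"
        by (rule sum_pos2[where i = l]) (use pl in auto)
      then have "W (p, 2) > 0"
        using prime_gt_0_nat[OF pl(1)]
        by (simp add: W_def log_weight_eq zero_less_mult_iff del: of_int_sum)
      moreover have "(p, 2) \<in> prime_power_index" using pl by (simp add: prime_power_index_def)
      ultimately have "\<exists>z\<in>prime_power_index. W z > 0" by blast
      then have "is_compound_poisson_char_fun
          (\<lambda>t. exp (\<Sum>\<^sub>az\<in>prime_power_index. W z *\<^sub>R (iexp (t \<bullet> - X z) - 1)))"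
        by (intro compound_poisson_weighted_points W_nonneg W X0)
      moreover have "normalized_Z m \<alpha> a \<sigma> =
          (\<lambda>t. exp (\<Sum>\<^sub>az\<in>prime_power_index. W z *\<^sub>R (iexp (t \<bullet> - X z) - 1)))"
        by (rule ext) (rule ZX)
      ultimately show ?thesis by simp
    qed
    obtain \<mu> where \<mu>: "prob_on_space \<mu>"
      "\<And>t. char_vec \<mu> t = exp (\<Sum>\<^sub>az\<in>prime_power_index. W z *\<^sub>R (nat_character (a \<bullet> t) (fst z ^ snd z) - 1))"
      using prime_power_law_exists[where a = a, OF W_nonneg W] by blast
    have "is_levy_measure \<mu> (reflect (euler_N m \<alpha> a \<sigma>))"
      unfolding N reflect_weighted_points
    proof (rule is_levy_measure_finite)
      show "infinitely_divisible \<mu>"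
        by (rule infinitely_divisible_prime_power_law[OF W_nonneg W \<mu>])
      show "finite_measure (weighted_points prime_power_index W (\<lambda>z. - X z))"
        by (rule finite_measure_weighted_points[OF W_nonneg W])
      show "emeasure (weighted_points prime_power_index W (\<lambda>z. - X z)) {0} = 0"
        by (rule emeasure_weighted_points_eq_0[OF X0])
      show "char_vec \<mu> t = exp (CLINT x|weighted_points prime_power_index W (\<lambda>z. - X z). iexp (t \<bullet> x) - 1)" for t
        unfolding \<mu>(2) Z[symmetric] ZX
        by (subst integral_weighted_points[OF W_nonneg]) auto
    qed simp
    then show "\<exists>\<mu>. prob_on_space \<mu>
                \<and> (\<forall>t. normalized_Z m \<alpha> a \<sigma> t = char_vec \<mu> t)
                \<and> is_levy_measure \<mu> (reflect (euler_N m \<alpha> a \<sigma>))"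
      using \<mu>(1) by (intro exI[of _ \<mu>] conjI allI) (simp_all only: \<mu>(2) Z)
  qed
  have "is_char_fun (normalized_Z m \<alpha> a \<sigma>)" if "\<forall>p. prime p \<longrightarrow> (\<Sum>l = 1..m. \<alpha> l p) \<ge> 0"
    using sufficient[OF that] unfolding is_char_fun_def by blast
  then have "is_char_fun (normalized_Z m \<alpha> a \<sigma>) \<longleftrightarrow>
      (\<forall>p. prime p \<longrightarrow> (\<Sum>l = 1..m. \<alpha> l p) \<ge> 0)"
    by (intro iffI allI impI necessary)
  then show ?thesis
    by (intro conjI[OF _ impI[OF sufficient]])
qed

end
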